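(* For problem (D) with $\Psi_\mu=\Psi_{+,\mu}$: (i) every stationary point of (D) is a local minimizer of $G$; (ii) if $w^*=[y^*;z^*]$ is a local minimizer of $G$ with $G(w^* )<\infty$ and the Slater condition $$\{w=[y;z]:\ -A^\top y-B^\top z\in\operatorname{ri}(\operatorname{dom}f^* ),\ y\in\operatorname{ri}(\operatorname{dom}g^* ),\ z_{\bar T_*}=0,\ z_{T_*}\ge0\}\neq\emptyset$$ holds, where $T_*=\{i:z^*_i\ne0\}$, $\bar T_*=[r]\setminus T_*$, and "$\operatorname{ri}$" may be omitted for $f^*$ (resp. $g^*$) when it is polyhedral, then $w^*$ is a stationary point of (D).
   Context: Let $f:\mathbb R^n\to(-\infty,\infty]$, $g:\mathbb R^m\to(-\infty,\infty]$ be proper, lsc and convex with conjugates $f^*,g^*$; $A\in\mathbb R^{m\times n}$, $B\in\mathbb R^{r\times n}$, $b\in\mathbb R^r$, $\mu\in\mathbb R^r$, $\mu>0$. For $w=[y;z]\in\mathbb R^m\times\mathbb R^r$: $\Xi(w)=f^*(-A^\top y-B^\top z)+g^*(y)+\langle b,z\rangle$, $\Psi_{+,\mu}(z)=\sum_i\mu_i\mathbf 1_{\{z_i\neq0\}}+\delta(z\mid\mathbb R^r_+)$, and (D) is $\min_w G(w)=\Xi(w)+\Psi_{+,\mu}(z)$. $\partial$ is the limiting subdifferential; $\partial\Psi_{+,\mu}(z)=\{u:u_i\in\mathbb R\text{ if }z_i=0,\ u_i=0\text{ otherwise}\}$ for $z\ge0$ and $\emptyset$ otherwise. $w^*$ is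 a stationary point of (D) if there exist $x\in\partial f^*(-A^\top y^*-B^\top z^* )$, $v\in\partial g^*(y^* )$, $u\in\partial\Psi_{+,\mu}(z^* )$ with $Ax=v$ and $Bx=b+u$. $\operatorname{ri}$ denotes relative interior. *)

theory Defs
  imports "HOL-Analysis.Analysis" "HOL-Library.Extended_Real"
begin

definition proper_fun :: "('a \<Rightarrow> ereal) \<Rightarrow> bool" where
  "proper_fun h \<longleftrightarrow> (\<forall>x. h x \<noteq> -\<infinity>) \<and> (\<exists>x. h x < \<infinity>)"

definition lsc_fun :: "('a::topological_space \<Rightarrow> ereal) \<Rightarrow> bool" where
  "lsc_fun h \<longleftrightarrow> (\<forall>x. h x \<le> Liminf (at x) h)"

definition convex_fun :: "('a::real_vector \<Rightarrow> ereal) \<Rightarrow> bool" where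
  "convex_fun h \<longleftrightarrow> (\<forall>x y t. 0 \<le> t \<and> t \<le> 1 \<longrightarrow>
      h ((1 - t) *\<^sub>R x + t *\<^sub>R y) \<le> ereal (1 - t) * h x + ereal t * h y)"

definition edom :: "('a \<Rightarrow> ereal) \<Rightarrow> 'a set" where
  "edom h = {x. h x < \<infinity>}"

definition conj_fun :: "('a::real_inner \<Rightarrow> ereal) \<Rightarrow> 'a \<Rightarrow> ereal" where
  "conj_fun h u = (SUP x. ereal (inner u x) - h x)"

definition polyhedral_fun :: "('a::euclidean_space \<Rightarrow> ereal) \<Rightarrow> bool" where
  "polyhedral_fun h \<longleftrightarrow> polyhedron {(x, t::real). h x \<le> ereal t}"

definition frechet_subdiff :: "('a::real_inner \<Rightarrow> ereal) \<Rightarrow> 'a \<Rightarrow> 'a set" where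
  "frechet_subdiff h x = {v. \<bar>h x\<bar> \<noteq> \<infinity> \<and>
      (\<forall>e>0. \<exists>d>0. \<forall>x'. norm (x' - x) < d \<longrightarrow>
         ereal (real_of_ereal (h x) + inner v (x' - x) - e * norm (x' - x)) \<le> h x')}"

definition limiting_subdiff :: "('a::real_inner \<Rightarrow> ereal) \<Rightarrow> 'a \<Rightarrow> 'a set" where
  "limiting_subdiff h x = {v. \<exists>xs vs. xs \<longlonglongrightarrow> x \<and> (\<lambda>k. h (xs k)) \<longlonglongrightarrow> h x \<and>
      (\<forall>k. vs k \<in> frechet_subdiff h (xs k)) \<and> vs \<longlonglongrightarrow> v}"

definition Psi_plus :: "real^'r \<Rightarrow> real^'r \<Rightarrow> ereal" where
  "Psi_plus \<mu> z = (if (\<forall>i. 0 \<le> z $ i)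
       then ereal (\<Sum>i\<in>UNIV. if z $ i \<noteq> 0 then \<mu> $ i else 0) else \<infinity>)"

definition Xi_fun :: "(real^'n \<Rightarrow> ereal) \<Rightarrow> (real^'m \<Rightarrow> ereal) \<Rightarrow> real^'n^'m \<Rightarrow> real^'n^'r
     \<Rightarrow> real^'r \<Rightarrow> (real^'m) \<times> (real^'r) \<Rightarrow> ereal" where
  "Xi_fun f g A B b w = (case w of (y, z) \<Rightarrow>
      conj_fun f (- (transpose A *v y) - (transpose B *v z)) + conj_fun g y + ereal (inner b z))"

definition G_fun :: "(real^'n \<Rightarrow> ereal) \<Rightarrow> (real^'m \<Rightarrow> ereal) \<Rightarrow> real^'n^'m \<Rightarrow> real^'n^'r
     \<Rightarrow> real^'r \<Rightarrow> real^'r \<Rightarrow> (real^'m) \<times> (real^'r) \<Rightarrow> ereal" where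
  "G_fun f g A B b \<mu> w = Xi_fun f g A B b w + Psi_plus \<mu> (snd w)"

definition local_minimizer :: "('a::metric_space \<Rightarrow> ereal) \<Rightarrow> 'a \<Rightarrow> bool" where
  "local_minimizer h x \<longleftrightarrow> (\<exists>e>0. \<forall>x'\<in>ball x e. h x \<le> h x')"

definition stationary_D :: "(real^'n \<Rightarrow> ereal) \<Rightarrow> (real^'m \<Rightarrow> ereal) \<Rightarrow> real^'n^'m \<Rightarrow> real^'n^'r
     \<Rightarrow> real^'r \<Rightarrow> real^'r \<Rightarrow> (real^'m) \<times> (real^'r) \<Rightarrow> bool" where
  "stationary_D f g A B b \<mu> w = (case w of (y, z) \<Rightarrow>
     (\<exists>x v u. x \<in> limiting_subdiff (conj_fun f) (- (transpose A *v y) - (transpose B *v z))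
        \<and> v \<in> limiting_subdiff (conj_fun g) y
        \<and> u \<in> limiting_subdiff (Psi_plus \<mu>) z
        \<and> A *v x = v \<and> B *v x = b + u))"

definition slater_D :: "(real^'n \<Rightarrow> ereal) \<Rightarrow> (real^'m \<Rightarrow> ereal) \<Rightarrow> real^'n^'m \<Rightarrow> real^'n^'r
     \<Rightarrow> real^'r \<Rightarrow> bool" where
  "slater_D f g A B zs = (\<exists>y z.
      - (transpose A *v y) - (transpose B *v z) \<in>
          (if polyhedral_fun (conj_fun f) then edom (conj_fun f) else rel_interior (edom (conj_fun f)))
    \<and> y \<in> (if polyhedral_fun (conj_fun g) then edom (conj_fun g) else rel_interior (edom (conj_fun g)))
    \<and> (\<forall>i. zs $ i = 0 \<longrightarrow> z $ i = 0)
    \<and> (\<forall>i. zs $ i \<noteq> 0 \<longrightarrow> 0 \<le> z $ i))"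

end

theory Submission
  imports Defs
begin

text \<open>
  Near a point \<open>z\<close> of the orthant the penalty jumps by \<open>\<mu>\<^sub>i\<close> whenever a zero coordinate becomes
  positive, so it dominates every linear term supported on the zero coordinates of \<open>z\<close>. Adding this
  to the subgradient inequalities of the two conjugates gives (i).

  Conversely the penalty is locally constant on the subspace of vectors supported in \<open>T\<^sub>*\<close>, so by
  convexity a local minimizer of \<open>G\<close> minimizes \<open>\<Xi>\<close> over that subspace. Lifted to epigraphs, this is
  the minimization of a linear function over \<open>epi f\<^sup>* \<times> epi g\<^sup>* \<times> \<real>\<^sup>r\<close> intersected with a subspace,
  and splitting its normal vector along the intersection yields the three subgradients at once. The
  sum rule for normal cones holds when the relative interiors meet, and the polyhedral part
  of an intersection need only meet the relative interior of the remaining convex set.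
\<close>

section \<open>Normal cones\<close>

definition normal_cone :: "'a::real_inner set \<Rightarrow> 'a \<Rightarrow> 'a set" where
  "normal_cone S x = {v. \<forall>y\<in>S. inner v (y - x) \<le> 0}"

lemma normal_cone_antimono: "S \<subseteq> T \<Longrightarrow> normal_cone T x \<subseteq> normal_cone S x"
  by (auto simp: normal_cone_def)

lemma normal_cone_add: "u \<in> normal_cone S x \<Longrightarrow> v \<in> normal_cone S x \<Longrightarrow> u + v \<in> normal_cone S x"
  by (auto simp: normal_cone_def inner_add_left intro: add_nonpos_nonpos)

lemma normal_cone_scaleR: "v \<in> normal_cone S x \<Longrightarrow> 0 \<le> c \<Longrightarrow> c *\<^sub>R v \<in> normal_cone S x"
  by (auto simp: normal_cone_def mult_nonneg_nonpos)

lemma normal_cone_plus_subset_Int: "normal_cone S x + normal_cone T x \<subseteq> normal_cone (S \<inter> T) x"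
  using normal_cone_antimono[of "S \<inter> T"] by (auto elim!: set_plus_elim intro!: normal_cone_add)

lemma normal_cone_Times:
  assumes "x \<in> S" "y \<in> T"
  shows "normal_cone (S \<times> T) (x, y) = normal_cone S x \<times> normal_cone T y"
proof (intro equalityI subsetI)
  fix p assume p: "p \<in> normal_cone (S \<times> T) (x, y)"
  obtain u v where "p = (u, v)" by fastforce
  then have "inner u (x' - x) + inner v (y' - y) \<le> 0" if "x' \<in> S" "y' \<in> T" for x' y'
    using p that by (auto simp: normal_cone_def)
  from this[of _ y] this[of x] show "p \<in> normal_cone S x \<times> normal_cone T y"
    using assms by (auto simp: normal_cone_def \<open>p = (u, v)\<close>)
qed (auto simp: normal_cone_def add_nonpos_nonpos)

lemma normal_cone_subspace:
  assumes "subspace V" "x \<in> V"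
  shows "normal_cone V x = {v. \<forall>y\<in>V. inner v y = 0}"
proof (intro equalityI subsetI CollectI ballI)
  fix v y assume v: "v \<in> normal_cone V x" and y: "y \<in> V"
  have "x + y \<in> V" "x - y \<in> V" using assms y by (auto intro: subspace_add subspace_diff)
  then have "inner v (x + y - x) \<le> 0" "inner v (x - y - x) \<le> 0"
    using v unfolding normal_cone_def by blast+
  then show "inner v y = 0" by simp
qed (use assms in \<open>auto simp: normal_cone_def inner_diff_right\<close>)

lemma normal_cone_hyperplane:
  assumes "inner a x = b"
  shows "normal_cone {y. inner a y = b} x = span {a}"
proof (intro equalityI subsetI)
  fix v assume v: "v \<in> normal_cone {y. inner a y = b} x"
  define \<nu> where "\<nu> = inner a v / inner a a"
  define d where "d = v - \<nu> *\<^sub>R a"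
  have orth: "inner a d = 0" by (simp add: d_def \<nu>_def inner_diff_right)
  then have "x + d \<in> {y. inner a y = b}" using assms by (simp add: inner_add_right)
  then have "inner v (x + d - x) \<le> 0"
    using v unfolding normal_cone_def by blast
  moreover have "inner v d = inner d d"
    using orth by (simp add: d_def inner_diff_left)
  ultimately have "d = 0" by (simp flip: not_less)
  then show "v \<in> span {a}" by (auto simp: d_def span_singleton)
qed (use assms in \<open>auto simp: normal_cone_def span_singleton inner_diff_right\<close>)

lemma rel_interior_above_ray:
  fixes S :: "('a::euclidean_space \<times> real) set"
  assumes S: "convex S" and x: "x \<in> rel_interior (fst ` S)"
    and ray: "{r..} \<subseteq> {t. (x, t) \<in> S}" and t: "r < t"
  shows "(x, t) \<in> rel_interior S"
proof -
  have "t \<in> rel_interior {t. (x, t) \<in> S}"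
    using interior_mono[OF ray] t interior_subset_rel_interior by fastforce
  moreover have "{y. {t. (y, t) \<in> S} \<noteq> {}} = fst ` S" by force
  ultimately show ?thesis
    using x by (simp add: rel_interior_projection[OF S refl])
qed

lemma nonvertical_supporting_hyperplane:
  fixes Q :: "('a::euclidean_space \<times> real) set"
  assumes Q: "convex Q" and ri: "(x, s) \<in> rel_interior Q" and point: "(x, r) \<in> Q" "r < s"
    and lower: "\<And>t. (x, t) \<in> Q \<Longrightarrow> r \<le> t"
  obtains u where "\<And>y t. (y, t) \<in> Q \<Longrightarrow> r + inner u (y - x) \<le> t"
proof -
  have "(x, r) \<notin> rel_interior Q"
  proof
    assume "(x, r) \<in> rel_interior Q"
    then obtain e where e: "1 < e" "(1 - e) *\<^sub>R (x, s) + e *\<^sub>R (x, r) \<in> Q"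
      using convex_rel_interior_iff[OF Q] ri rel_interior_subset by blast
    moreover have "(1 - e) *\<^sub>R (x, s) + e *\<^sub>R (x, r) = (x, r - (e - 1) * (s - r))"
      by (simp add: algebra_simps)
    ultimately have "0 \<le> - ((e - 1) * (s - r))" using lower by fastforce
    then show False using e(1) point(2) by (simp add: mult_le_0_iff)
  qed
  then obtain w \<tau> where supporting: "\<And>p. p \<in> Q \<Longrightarrow> inner (w, \<tau>) (x, r) \<le> inner (w, \<tau>) p"
    and strictly_supporting: "\<And>p. p \<in> rel_interior Q \<Longrightarrow> inner (w, \<tau>) (x, r) < inner (w, \<tau>) p"
    using supporting_hyperplane_rel_boundary[OF Q point(1)] by (metis surj_pair)
  have \<tau>: "0 < \<tau>"
    using strictly_supporting[OF ri] point(2) by (simp add: mult_less_cancel_left_disj)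
  show ?thesis
  proof
    fix y t assume "(y, t) \<in> Q"
    then have "\<tau> * r + inner w x \<le> inner w y + \<tau> * t" using supporting by fastforce
    then show "r + inner (- w /\<^sub>R \<tau>) (y - x) \<le> t"
      using \<tau> by (simp add: field_simps inner_diff_right)
  qed
qed

lemma linear_constraint_multiplier:
  fixes K :: "'a::euclidean_space \<Rightarrow> 'b::euclidean_space"
  assumes C: "convex C" and K: "linear K" and x0: "x0 \<in> rel_interior C" "K x0 = 0"
    and x1: "x1 \<in> C" "K x1 = 0"
    and min: "\<And>x. x \<in> C \<Longrightarrow> K x = 0 \<Longrightarrow> inner c x1 \<le> inner c x"
  obtains u where "\<And>x. x \<in> C \<Longrightarrow> inner c x1 + inner u (K x) \<le> inner c x"
proof -
  define E where "E = epigraph C (inner c)"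
  define Q where "Q = (\<lambda>(x, t). (K x, t)) ` E"
  have lift_linear: "linear (\<lambda>(x, t::real). (K x, t))"
    by (rule linearI) (auto simp: linear_add[OF K] linear_scale[OF K])
  have E: "convex E"
    unfolding E_def convex_epigraph using C by (simp add: convex_on_def inner_add_right)
  have "fst ` E = C" by (fastforce simp: E_def epigraph_def image_iff)
  then have "(x0, inner c x0 + 1) \<in> rel_interior E"
    using x0 rel_interior_subset
    by (intro rel_interior_above_ray[OF E, of _ "inner c x0"]) (auto simp: E_def epigraph_def)
  then have ri: "(0, inner c x0 + 1) \<in> rel_interior Q"
    unfolding Q_def rel_interior_convex_linear_image[OF lift_linear E, symmetric] using x0 by force
  have Q_mem: "(K x, inner c x) \<in> Q" if "x \<in> C" for x
    using that by (force simp: Q_def E_def epigraph_def)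
  have Q: "convex Q" unfolding Q_def using lift_linear E by (rule convex_linear_image)
  have lower: "inner c x1 \<le> t" if "(0, t) \<in> Q" for t
    using that order_trans[OF min] by (force simp: Q_def E_def epigraph_def)
  have "(0, inner c x1) \<in> Q" "inner c x1 < inner c x0 + 1"
    using Q_mem x1 min x0 rel_interior_subset by force+
  from nonvertical_supporting_hyperplane[OF Q ri this lower]
  obtain u where u: "\<And>y t. (y, t) \<in> Q \<Longrightarrow> inner c x1 + inner u (y - 0) \<le> t" by metis
  show ?thesis
  proof
    show "inner c x1 + inner u (K x) \<le> inner c x" if "x \<in> C" for x
      using u[OF Q_mem[OF that]] by simp
  qed
qed

definition normal_cone_sum_rule :: "'a::real_inner set \<Rightarrow> 'a set \<Rightarrow> 'a \<Rightarrow> bool" where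
  "normal_cone_sum_rule C D x \<longleftrightarrow> normal_cone (C \<inter> D) x \<subseteq> normal_cone C x + normal_cone D x"

lemma normal_cone_sum_ruleE:
  assumes "normal_cone_sum_rule C D x" "v \<in> normal_cone (C \<inter> D) x"
  obtains p q where "p \<in> normal_cone C x" "q \<in> normal_cone D x" "v = p + q"
  using assms unfolding normal_cone_sum_rule_def by (blast elim: set_plus_elim)

lemma normal_cone_sum_rule_rel_interior:
  fixes C D :: "'a::euclidean_space set"
  assumes C: "convex C" and D: "convex D" and x0: "x0 \<in> rel_interior C \<inter> rel_interior D"
    and x: "x \<in> C \<inter> D"
  shows "normal_cone_sum_rule C D x"
  unfolding normal_cone_sum_rule_def
proof
  fix v assume v: "v \<in> normal_cone (C \<inter> D) x"
  obtain u where u: "inner (- v, 0) (x, x) + inner u (fst p - snd p) \<le> inner (- v, 0) p"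
    if "p \<in> C \<times> D" for p
  proof (rule linear_constraint_multiplier)
    show "convex (C \<times> D)" using C D by (rule convex_Times)
    show "linear (\<lambda>p::'a \<times> 'a. fst p - snd p)" by (rule linearI) (auto simp: algebra_simps)
    show "(x0, x0) \<in> rel_interior (C \<times> D)" using x0 C D by (simp add: rel_interior_Times)
    show "inner (- v, 0) (x, x) \<le> inner (- v, 0) p" if "p \<in> C \<times> D" "fst p - snd p = 0" for p
      using v that by (cases p) (auto simp: normal_cone_def inner_diff_right)
  qed (use x in auto)
  have "- u \<in> normal_cone D x"
    using u[of "(x, _)"] x by (auto simp: normal_cone_def inner_diff_right)
  moreover have "v + u \<in> normal_cone C x"
    using u[of "(_, x)"] x by (auto simp: normal_cone_def algebra_simps)
  ultimately show "v \<in> normal_cone C x + normal_cone D x"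
    using set_plus_intro[of "v + u" _ "- u"] by simp
qed

lemma normal_cone_sum_rule_assoc:
  assumes "normal_cone_sum_rule (C \<inter> H) P x" "normal_cone_sum_rule C H x"
  shows "normal_cone_sum_rule C (H \<inter> P) x"
proof -
  have "normal_cone (C \<inter> (H \<inter> P)) x \<subseteq> normal_cone (C \<inter> H) x + normal_cone P x"
    using assms(1) by (simp add: normal_cone_sum_rule_def Int_assoc)
  also have "\<dots> \<subseteq> (normal_cone C x + normal_cone H x) + normal_cone P x"
    using assms(2) unfolding normal_cone_sum_rule_def by (rule set_plus_mono2) simp
  also have "\<dots> \<subseteq> normal_cone C x + normal_cone (H \<inter> P) x"
    unfolding add.assoc by (intro set_plus_mono2 order_refl normal_cone_plus_subset_Int)
  finally show ?thesis unfolding normal_cone_sum_rule_def .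
qed

lemma rel_interior_strict_halfspace:
  fixes a :: "'a::euclidean_space"
  assumes "inner a y < b"
  shows "y \<in> rel_interior {z. inner a z \<le> b}"
proof -
  have "{z. inner a z < b} \<subseteq> interior {z. inner a z \<le> b}"
    by (intro interior_maximal open_halfspace_lt) auto
  then show ?thesis using assms interior_subset_rel_interior by blast
qed

lemma strict_halfspace_meets_rel_interior:
  fixes C P :: "'a::euclidean_space set"
  assumes C: "convex C" and P: "convex P"
    and x0: "x0 \<in> rel_interior C \<inter> P" "inner a x0 \<le> b"
    and x1: "x1 \<in> C \<inter> P" "inner a x1 < b"
  obtains y where "y \<in> rel_interior C \<inter> P" "inner a y < b"
proof
  define y where "y = (1/2) *\<^sub>R x1 + (1/2) *\<^sub>R x0"
  have "y = x1 - (1/2) *\<^sub>R (x1 - x0)"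
    by (simp add: y_def algebra_simps flip: scaleR_add_left)
  then have "y \<in> rel_interior C"
    using rel_interior_convex_shrink[OF C, of x0 x1 "1/2"] x0 x1 by simp
  moreover have "y \<in> P"
    unfolding y_def using x0 x1 by (intro convexD[OF P]) auto
  ultimately show "y \<in> rel_interior C \<inter> P" ..
  show "inner a y < b" using x0 x1 by (simp add: y_def inner_add_right)
qed

lemma normal_cone_sum_rule_tight_halfspace:
  assumes x: "inner a x = b"
    and rule_level: "normal_cone_sum_rule (C \<inter> {y. inner a y = b}) P x"
    and rule_hyperplane: "normal_cone_sum_rule C {y. inner a y = b} x"
    and neg_normal: "- a \<in> normal_cone C x + normal_cone P x"
  shows "normal_cone_sum_rule C ({y. inner a y \<le> b} \<inter> P) x"
  unfolding normal_cone_sum_rule_def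
proof
  let ?H = "{y. inner a y \<le> b}"
  fix v assume "v \<in> normal_cone (C \<inter> (?H \<inter> P)) x"
  then have "v \<in> normal_cone ((C \<inter> {y. inner a y = b}) \<inter> P) x"
    by (rule subsetD[OF normal_cone_antimono, rotated]) auto
  then obtain p q where p: "p \<in> normal_cone (C \<inter> {y. inner a y = b}) x"
    and q: "q \<in> normal_cone P x" and v: "v = p + q"
    by (rule normal_cone_sum_ruleE[OF rule_level])
  obtain p' \<nu> where p': "p' \<in> normal_cone C x" and p_eq: "p = p' + \<nu> *\<^sub>R a"
    using normal_cone_sum_ruleE[OF rule_hyperplane p]
    unfolding normal_cone_hyperplane[OF x] span_singleton by blast
  have P_subset: "normal_cone P x \<subseteq> normal_cone (?H \<inter> P) x"
    by (rule normal_cone_antimono) simp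
  show "v \<in> normal_cone C x + normal_cone (?H \<inter> P) x"
  proof (cases "0 \<le> \<nu>")
    case True
    have "a \<in> normal_cone (?H \<inter> P) x"
      using x by (auto simp: normal_cone_def inner_diff_right)
    then have "\<nu> *\<^sub>R a + q \<in> normal_cone (?H \<inter> P) x"
      using True q P_subset by (intro normal_cone_add normal_cone_scaleR) auto
    then show ?thesis using p' by (auto simp: v p_eq add.assoc)
  next
    case False
    obtain c d where c: "c \<in> normal_cone C x" and d: "d \<in> normal_cone P x" and a: "- a = c + d"
      using neg_normal by (auto elim: set_plus_elim)
    have "p' + (- \<nu>) *\<^sub>R c \<in> normal_cone C x"
      using p' c False by (intro normal_cone_add normal_cone_scaleR) auto
    moreover have "(- \<nu>) *\<^sub>R d + q \<in> normal_cone (?H \<inter> P) x"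
      using q d False by (intro subsetD[OF P_subset] normal_cone_add normal_cone_scaleR) auto
    moreover have "\<nu> *\<^sub>R a = (- \<nu>) *\<^sub>R (c + d)" by (simp flip: a)
    then have "v = (p' + (- \<nu>) *\<^sub>R c) + ((- \<nu>) *\<^sub>R d + q)"
      by (simp add: v p_eq scaleR_add_right)
    ultimately show ?thesis by auto
  qed
qed

lemma normal_cone_sum_rule_insert_halfspace:
  fixes C P :: "'a::euclidean_space set"
  assumes C: "convex C" and P: "convex P"
    and x0: "x0 \<in> rel_interior C \<inter> P" "inner a x0 \<le> b" and x: "x \<in> C \<inter> P" "inner a x \<le> b"
    and rule: "\<And>C' y. convex C' \<Longrightarrow> y \<in> rel_interior C' \<inter> P \<Longrightarrow> x \<in> C' \<inter> P \<Longrightarrow>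
      normal_cone_sum_rule C' P x"
  shows "normal_cone_sum_rule C ({y. inner a y \<le> b} \<inter> P) x"
proof -
  have rule_D: "normal_cone_sum_rule C D x"
    if "y \<in> rel_interior C \<inter> P" "y \<in> rel_interior D" "convex D" "x \<in> D" for D y
    using that x C by (intro normal_cone_sum_rule_rel_interior[of _ _ y]) auto
  have rule_Int_D: "normal_cone_sum_rule (C \<inter> D) P x"
    if "y \<in> rel_interior C \<inter> P" "y \<in> rel_interior D" "convex D" "x \<in> D" for D y
  proof (rule rule)
    show "convex (C \<inter> D)" using C that(3) by (rule convex_Int)
    have "rel_interior (C \<inter> D) = rel_interior C \<inter> rel_interior D"
      using that by (intro convex_rel_interior_inter_two C) auto
    then show "y \<in> rel_interior (C \<inter> D) \<inter> P" using that by simp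
  qed (use that x in simp)
  show ?thesis
  proof (cases "\<exists>x1 \<in> C \<inter> P. inner a x1 < b")
    case True
    then obtain y where y: "y \<in> rel_interior C \<inter> P" "inner a y < b"
      using strict_halfspace_meets_rel_interior[OF C P x0] by metis
    then have "y \<in> rel_interior {z. inner a z \<le> b}" by (intro rel_interior_strict_halfspace)
    then show ?thesis
      using y(1) x(2) by (intro normal_cone_sum_rule_assoc rule_D rule_Int_D)
        (auto simp: convex_halfspace_le)
  next
    case False
    \<comment> \<open>The constraint is active at every feasible point, so \<open>- a\<close> is itself normal to \<open>C \<inter> P\<close> and a
      multiplier of \<open>a\<close> of either sign is admissible.\<close>
    then have a_ge: "b \<le> inner a y" if "y \<in> C \<inter> P" for y
      using that not_less by blast
    then have tight: "inner a x0 = b" "inner a x = b"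
      using x0 x rel_interior_subset by (auto intro!: antisym)
    have "- a \<in> normal_cone (C \<inter> P) x"
      using a_ge tight by (auto simp: normal_cone_def inner_diff_right)
    then have "- a \<in> normal_cone C x + normal_cone P x"
      using rule[OF C x0(1) x(1)] unfolding normal_cone_sum_rule_def by blast
    moreover have "rel_interior {y. inner a y = b} = {y. inner a y = b}"
      by (rule rel_interior_affine[OF affine_hyperplane])
    ultimately show ?thesis
      using tight x0(1)
      by (intro normal_cone_sum_rule_tight_halfspace rule_D rule_Int_D)
        (auto simp: convex_hyperplane)
  qed
qed

lemma polyhedron_halfspacesE:
  assumes "polyhedron P"
  obtains \<H> where "finite \<H>" "P = \<Inter>\<H>" "\<And>H. H \<in> \<H> \<Longrightarrow> \<exists>a b. H = {y. inner a y \<le> b}"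
  using assms unfolding polyhedron_def by metis

theorem normal_cone_sum_rule_polyhedron:
  fixes C P :: "'a::euclidean_space set"
  assumes "convex C" "polyhedron P" "x0 \<in> rel_interior C \<inter> P" "x \<in> C \<inter> P"
  shows "normal_cone_sum_rule C P x"
proof -
  obtain \<H> where \<H>: "finite \<H>" "P = \<Inter>\<H>" "\<And>H. H \<in> \<H> \<Longrightarrow> \<exists>a b. H = {y. inner a y \<le> b}"
    using polyhedron_halfspacesE[OF assms(2)] by metis
  have "normal_cone_sum_rule C (\<Inter>\<H>) x"
    using \<H>(1,3) assms(1) assms(3,4)[unfolded \<H>(2)]
  proof (induction \<H> arbitrary: C x0 rule: finite_induct)
    case empty
    then show ?case
      by (intro normal_cone_sum_rule_rel_interior) auto
  next
    case (insert H \<H>)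
    obtain a b where H: "H = {y. inner a y \<le> b}" using insert.prems(1) by blast
    have "convex (\<Inter>\<H>)"
      using insert.prems(1) by (metis convex_Inter convex_halfspace_le insertCI)
    then have "normal_cone_sum_rule C ({y. inner a y \<le> b} \<inter> \<Inter>\<H>) x"
      using insert.prems insert.IH unfolding H
      by (intro normal_cone_sum_rule_insert_halfspace[where ?x0.0 = x0]) auto
    then show ?case by (simp add: H)
  qed
  then show ?thesis using \<H>(2) by simp
qed

lemma polyhedron_linear_vimage:
  fixes K :: "'a::euclidean_space \<Rightarrow> 'b::euclidean_space"
  assumes K: "linear K" and P: "polyhedron P"
  shows "polyhedron (K -` P)"
proof -
  obtain \<H> where \<H>: "finite \<H>" "P = \<Inter>\<H>" "\<And>H. H \<in> \<H> \<Longrightarrow> \<exists>a b. H = {y. inner a y \<le> b}"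
    using polyhedron_halfspacesE[OF P] by metis
  have "polyhedron (K -` H)" if "H \<in> \<H>" for H
  proof -
    obtain a b where "H = {y. inner a y \<le> b}" using \<H>(3) \<open>H \<in> \<H>\<close> by blast
    then have "K -` H = {x. inner (adjoint K a) x \<le> b}"
      by (simp add: adjoint_clauses(2)[OF K])
    then show ?thesis by (simp add: polyhedron_halfspace_le)
  qed
  moreover have "K -` P = \<Inter>((\<lambda>H. K -` H) ` \<H>)" by (auto simp: \<H>(2))
  ultimately show ?thesis using \<H>(1) by (auto intro!: polyhedron_Inter)
qed

lemma polyhedron_Times:
  fixes P :: "'a::euclidean_space set" and Q :: "'b::euclidean_space set"
  assumes "polyhedron P" "polyhedron Q"
  shows "polyhedron (P \<times> Q)"
proof -
  have "P \<times> Q = fst -` P \<inter> snd -` Q" by auto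
  then show ?thesis
    using assms by (simp add: polyhedron_linear_vimage linear_fst linear_snd)
qed

definition qualified_at :: "'a::euclidean_space set \<Rightarrow> 'a \<Rightarrow> bool" where
  "qualified_at E x \<longleftrightarrow> (\<exists>C P. convex C \<and> polyhedron P \<and> E = C \<inter> P \<and> x \<in> rel_interior C \<inter> P)"

lemma qualified_at_rel_interior: "convex E \<Longrightarrow> x \<in> rel_interior E \<Longrightarrow> qualified_at E x"
  unfolding qualified_at_def by (intro exI[of _ E] exI[of _ UNIV]) auto

lemma qualified_at_polyhedron: "polyhedron E \<Longrightarrow> x \<in> E \<Longrightarrow> qualified_at E x"
  unfolding qualified_at_def by (intro exI[of _ UNIV] exI[of _ E]) auto

lemma qualified_at_Times:
  assumes "qualified_at E x" "qualified_at F y"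
  shows "qualified_at (E \<times> F) (x, y)"
proof -
  obtain C P D Q where "convex C" "polyhedron P" "E = C \<inter> P" "x \<in> rel_interior C \<inter> P"
    "convex D" "polyhedron Q" "F = D \<inter> Q" "y \<in> rel_interior D \<inter> Q"
    using assms unfolding qualified_at_def by blast
  moreover from this have "E \<times> F = (C \<times> D) \<inter> (P \<times> Q)" by auto
  ultimately show ?thesis
    unfolding qualified_at_def
    by (intro exI[of _ "C \<times> D"] exI[of _ "P \<times> Q"])
      (simp add: convex_Times polyhedron_Times rel_interior_Times)
qed

lemma normal_cone_sum_rule_qualified:
  assumes "qualified_at E x0" "convex D" "x0 \<in> rel_interior D" "x \<in> E \<inter> D"
  shows "normal_cone_sum_rule E D x"
proof -
  obtain C P where C: "convex C" and P: "polyhedron P" and E: "E = C \<inter> P"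
    and x0: "x0 \<in> rel_interior C \<inter> P"
    using assms(1) unfolding qualified_at_def by blast
  have x0_Int: "x0 \<in> rel_interior (D \<inter> C) \<inter> P"
    using convex_rel_interior_inter_two[OF assms(2) C] x0 assms(3) by blast
  have "normal_cone_sum_rule D (C \<inter> P) x"
  proof (rule normal_cone_sum_rule_assoc)
    show "normal_cone_sum_rule (D \<inter> C) P x"
      using x0_Int assms(2,4) C P E
      by (intro normal_cone_sum_rule_polyhedron[OF _ _ x0_Int] convex_Int) auto
    show "normal_cone_sum_rule D C x"
      using assms C E x0 by (intro normal_cone_sum_rule_rel_interior[of _ _ x0]) auto
  qed
  then show ?thesis
    unfolding E normal_cone_sum_rule_def by (simp add: Int_commute add.commute)
qed

section \<open>Convex functions with extended real values\<close>

definition epi :: "('a \<Rightarrow> ereal) \<Rightarrow> ('a \<times> real) set" where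
  "epi h = {(x, t). h x \<le> ereal t}"

definition subdiff :: "('a::real_inner \<Rightarrow> ereal) \<Rightarrow> 'a \<Rightarrow> 'a set" where
  "subdiff h x = {v. \<bar>h x\<bar> \<noteq> \<infinity> \<and> (\<forall>y. h x + ereal (inner v (y - x)) \<le> h y)}"

lemma convex_fun_combination_le:
  assumes "convex_fun h" "h x \<le> ereal \<alpha>" "h y \<le> ereal \<beta>" "0 \<le> t" "t \<le> 1"
  shows "h ((1 - t) *\<^sub>R x + t *\<^sub>R y) \<le> ereal ((1 - t) * \<alpha> + t * \<beta>)"
proof -
  have "h ((1 - t) *\<^sub>R x + t *\<^sub>R y) \<le> ereal (1 - t) * h x + ereal t * h y"
    using assms by (simp add: convex_fun_def)
  also have "\<dots> \<le> ereal (1 - t) * ereal \<alpha> + ereal t * ereal \<beta>"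
    using assms by (intro add_mono ereal_mult_left_mono) auto
  finally show ?thesis by simp
qed

lemma convex_epi: "convex_fun h \<Longrightarrow> convex (epi h)"
  unfolding convex_alt by (auto simp: epi_def intro: convex_fun_combination_le)

lemma convex_fun_add:
  assumes "convex_fun h" "convex_fun k"
  shows "convex_fun (\<lambda>x. h x + k x)"
  unfolding convex_fun_def
proof (intro allI impI)
  fix x y and t :: real assume t: "0 \<le> t \<and> t \<le> 1"
  have "h ((1 - t) *\<^sub>R x + t *\<^sub>R y) + k ((1 - t) *\<^sub>R x + t *\<^sub>R y)
      \<le> (ereal (1 - t) * h x + ereal t * h y) + (ereal (1 - t) * k x + ereal t * k y)"
    using assms t by (intro add_mono) (simp_all add: convex_fun_def)
  also have "\<dots> = ereal (1 - t) * (h x + k x) + ereal t * (h y + k y)"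
    using t by (simp add: ereal_pos_distrib ac_simps)
  finally show "h ((1 - t) *\<^sub>R x + t *\<^sub>R y) + k ((1 - t) *\<^sub>R x + t *\<^sub>R y) \<le> \<dots>" .
qed

lemma convex_fun_linear_compose: "linear L \<Longrightarrow> convex_fun h \<Longrightarrow> convex_fun (\<lambda>x. h (L x))"
  by (simp add: convex_fun_def linear_add linear_scale)

lemma convex_fun_inner: "convex_fun (\<lambda>x. ereal (inner c x))"
  by (simp add: convex_fun_def inner_add_right)

lemma convex_fun_SUP:
  assumes "\<And>i. convex_fun (h i)"
  shows "convex_fun (\<lambda>x. SUP i. h i x)"
  unfolding convex_fun_def
proof (intro allI impI SUP_least)
  fix x y i and t :: real assume t: "0 \<le> t \<and> t \<le> 1"
  have "h i ((1 - t) *\<^sub>R x + t *\<^sub>R y) \<le> ereal (1 - t) * h i x + ereal t * h i y"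
    using assms t by (simp add: convex_fun_def)
  also have "\<dots> \<le> ereal (1 - t) * (SUP i. h i x) + ereal t * (SUP i. h i y)"
    using t by (intro add_mono ereal_mult_left_mono SUP_upper) auto
  finally show "h i ((1 - t) *\<^sub>R x + t *\<^sub>R y) \<le> \<dots>" .
qed

lemma convex_fun_conj_fun: "convex_fun (conj_fun f)"
  unfolding conj_fun_def
proof (rule convex_fun_SUP)
  fix x show "convex_fun (\<lambda>u. ereal (inner u x) - f x)"
  proof (cases "f x")
    case (real r)
    then show ?thesis by (simp add: convex_fun_def inner_add_left algebra_simps)
  next
    case MInf
    have "ereal (1 - t) * \<infinity> + ereal t * \<infinity> = \<infinity>" if "0 \<le> t \<and> t \<le> 1" for t
      using that by (cases "t = 0") auto
    then show ?thesis by (simp add: MInf convex_fun_def)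
  qed (simp add: convex_fun_def)
qed

lemma conj_fun_not_MInfty:
  assumes "proper_fun f"
  shows "conj_fun f u \<noteq> -\<infinity>"
proof -
  obtain x where "f x \<noteq> -\<infinity>" "f x < \<infinity>" using assms unfolding proper_fun_def by blast
  then have "ereal (inner u x) - f x \<noteq> -\<infinity>" by (cases "f x") auto
  moreover have "ereal (inner u x) - f x \<le> conj_fun f u"
    unfolding conj_fun_def by (rule SUP_upper) simp
  ultimately show ?thesis by auto
qed

lemma subdiff_iff_normal_cone_epi:
  assumes "h x = ereal r"
  shows "v \<in> subdiff h x \<longleftrightarrow> (v, -1) \<in> normal_cone (epi h) (x, r)"
proof
  assume "v \<in> subdiff h x"
  then have "ereal (r + inner v (y - x)) \<le> ereal t" if "h y \<le> ereal t" for y t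
    using order_trans[OF _ that] assms by (auto simp: subdiff_def simp del: ereal_less_eq)
  then show "(v, -1) \<in> normal_cone (epi h) (x, r)"
    by (force simp: normal_cone_def epi_def)
next
  assume "(v, -1) \<in> normal_cone (epi h) (x, r)"
  then have "ereal r + ereal (inner v (y - x)) \<le> ereal t" if "h y \<le> ereal t" for y t
    using that by (force simp: normal_cone_def epi_def)
  then show "v \<in> subdiff h x"
    by (auto simp: subdiff_def assms intro: ereal_le_real)
qed

lemma edom_eq_fst_epi: "edom h = fst ` epi h"
proof -
  have "\<exists>t. h x \<le> ereal t" if "h x < \<infinity>" for x
    using that by (cases "h x") auto
  then show ?thesis by (force simp: edom_def epi_def)
qed

definition qualified_domain :: "('a::euclidean_space \<Rightarrow> ereal) \<Rightarrow> 'a set" where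
  "qualified_domain h = (if polyhedral_fun h then edom h else rel_interior (edom h))"

lemma qualified_at_epi:
  assumes h: "convex_fun h" and x: "x \<in> qualified_domain h"
  obtains t where "qualified_at (epi h) (x, t)"
proof -
  have "x \<in> edom h"
    using x rel_interior_subset by (auto simp: qualified_domain_def split: if_splits)
  then obtain r where r: "h x \<le> ereal r" by (auto simp: edom_eq_fst_epi epi_def)
  show ?thesis
  proof (cases "polyhedral_fun h")
    case True
    then show ?thesis
      using r by (intro that[of r] qualified_at_polyhedron) (auto simp: polyhedral_fun_def epi_def)
  next
    case False
    have "{r..} \<subseteq> {t. (x, t) \<in> epi h}"
      using r by (auto simp: epi_def intro: order_trans)
    with False x show ?thesis
      using convex_epi[OF h]
      by (intro that[of "r + 1"] qualified_at_rel_interior rel_interior_above_ray[of _ _ r])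
        (auto simp: qualified_domain_def edom_eq_fst_epi)
  qed
qed

definition lifted_graph ::
    "('c \<Rightarrow> 'a) \<Rightarrow> ('c \<Rightarrow> 'b) \<Rightarrow> (('a \<times> real) \<times> ('b \<times> real) \<times> 'c) set" where
  "lifted_graph L M = {((p, \<alpha>), (q, \<beta>), w). p = L w \<and> q = M w}"

lemma subspace_lifted_graph:
  assumes "linear L" "linear M"
  shows "subspace (lifted_graph L M)"
  using assms
  by (intro subspaceI) (auto simp: lifted_graph_def zero_prod_def linear_0 linear_add linear_scale)

lemma normal_cone_lifted_graph:
  assumes L: "linear L" and M: "linear M" and e: "e \<in> lifted_graph L M"
  shows "normal_cone (lifted_graph L M) e =
    {((x, \<alpha>), (v, \<beta>), d). \<alpha> = 0 \<and> \<beta> = 0 \<and> (\<forall>w. inner x (L w) + inner v (M w) + inner d w = 0)}"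
  unfolding normal_cone_subspace[OF subspace_lifted_graph[OF L M] e]
proof (intro equalityI subsetI)
  fix m assume "m \<in> {m. \<forall>y\<in>lifted_graph L M. inner m y = 0}"
  moreover obtain x \<alpha> v \<beta> d where m: "m = ((x, \<alpha>), (v, \<beta>), d)" by (metis surj_pair)
  ultimately have orth: "inner x (L w) + \<alpha> * a + (inner v (M w) + \<beta> * b + inner d w) = 0" for w a b
    by (auto simp: lifted_graph_def)
  have "\<alpha> = 0" "\<beta> = 0"
    using orth[of 0 1 0] orth[of 0 0 1] by (simp_all add: linear_0[OF L] linear_0[OF M])
  then show "m \<in> {((x, \<alpha>), (v, \<beta>), d).
      \<alpha> = 0 \<and> \<beta> = 0 \<and> (\<forall>w. inner x (L w) + inner v (M w) + inner d w = 0)}"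
    using orth by (simp add: m add.assoc)
qed (auto simp: lifted_graph_def add.assoc)

lemma convex_sum_min_imp_normal_to_lifted_graph:
  assumes r: "F (L w) = ereal r" and s: "G (M w) = ereal s"
    and min: "\<And>w'. w' \<in> U \<Longrightarrow>
      F (L w) + G (M w) + ereal (inner c w) \<le> F (L w') + G (M w') + ereal (inner c w')"
  shows "((0, -1), (0, -1), - c) \<in>
    normal_cone ((epi F \<times> epi G \<times> U) \<inter> lifted_graph L M) ((L w, r), (M w, s), w)"
proof -
  have "r + s + inner c w \<le> \<alpha> + \<beta> + inner c w'"
    if "F (L w') \<le> ereal \<alpha>" "G (M w') \<le> ereal \<beta>" "w' \<in> U" for \<alpha> \<beta> w'
  proof -
    have "ereal (r + s + inner c w) \<le> F (L w') + G (M w') + ereal (inner c w')"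
      using min[OF \<open>w' \<in> U\<close>] by (simp add: r s)
    also have "\<dots> \<le> ereal \<alpha> + ereal \<beta> + ereal (inner c w')"
      using that by (intro add_mono) auto
    finally show ?thesis by simp
  qed
  then show ?thesis
    by (force simp: normal_cone_def lifted_graph_def epi_def inner_diff_right)
qed

lemma rel_interior_subspace: "subspace S \<Longrightarrow> rel_interior S = S"
  for S :: "'a::euclidean_space set"
  by (intro rel_interior_affine subspace_imp_affine)

lemma normal_cone_sum_rule_lifted_graph:
  fixes F :: "'a::euclidean_space \<Rightarrow> ereal" and G :: "'b::euclidean_space \<Rightarrow> ereal"
    and U :: "'c::euclidean_space set"
  assumes F: "convex_fun F" and G: "convex_fun G"
    and L: "linear L" and M: "linear M" and U: "subspace U"
    and w0: "w0 \<in> U" "L w0 \<in> qualified_domain F" "M w0 \<in> qualified_domain G"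
    and e: "e \<in> (epi F \<times> epi G \<times> U) \<inter> lifted_graph L M"
  shows "normal_cone_sum_rule (epi F \<times> epi G \<times> U) (lifted_graph L M) e"
proof -
  obtain t1 t2 where "qualified_at (epi F) (L w0, t1)" "qualified_at (epi G) (M w0, t2)"
    using qualified_at_epi[OF F w0(2)] qualified_at_epi[OF G w0(3)] by metis
  moreover have "qualified_at U w0"
    using U w0(1) by (intro qualified_at_rel_interior subspace_imp_convex)
      (auto simp: rel_interior_subspace)
  ultimately have "qualified_at (epi F \<times> epi G \<times> U) ((L w0, t1), (M w0, t2), w0)"
    by (intro qualified_at_Times)
  moreover have "((L w0, t1), (M w0, t2), w0) \<in> rel_interior (lifted_graph L M)"
    unfolding rel_interior_subspace[OF subspace_lifted_graph[OF L M]]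
    by (simp add: lifted_graph_def)
  ultimately show ?thesis
    using e
    by (intro normal_cone_sum_rule_qualified subspace_imp_convex subspace_lifted_graph L M) auto
qed

theorem convex_sum_min_on_subspace_imp_subgradients:
  fixes F :: "'a::euclidean_space \<Rightarrow> ereal" and G :: "'b::euclidean_space \<Rightarrow> ereal"
    and L :: "'c::euclidean_space \<Rightarrow> 'a" and M :: "'c \<Rightarrow> 'b"
  assumes F: "convex_fun F" and G: "convex_fun G"
    and L: "linear L" and M: "linear M" and U: "subspace U"
    and w0: "w0 \<in> U" "L w0 \<in> qualified_domain F" "M w0 \<in> qualified_domain G"
    and w: "w \<in> U" "\<bar>F (L w)\<bar> \<noteq> \<infinity>" "\<bar>G (M w)\<bar> \<noteq> \<infinity>"
    and min: "\<And>w'. w' \<in> U \<Longrightarrow>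
      F (L w) + G (M w) + ereal (inner c w) \<le> F (L w') + G (M w') + ereal (inner c w')"
  obtains x v where "x \<in> subdiff F (L w)" "v \<in> subdiff G (M w)"
    "\<And>w'. w' \<in> U \<Longrightarrow> inner x (L w') + inner v (M w') + inner c w' = 0"
proof -
  obtain r s where r: "F (L w) = ereal r" and s: "G (M w) = ereal s" using w(2,3) by auto
  let ?E = "epi F \<times> epi G \<times> U" and ?V = "lifted_graph L M" and ?e = "((L w, r), (M w, s), w)"
  have e: "?e \<in> ?E \<inter> ?V" using r s w(1) by (auto simp: lifted_graph_def epi_def)
  have "normal_cone_sum_rule ?E ?V ?e"
    using F G L M U w0 e by (rule normal_cone_sum_rule_lifted_graph)
  moreover have "((0, -1), (0, -1), - c) \<in> normal_cone (?E \<inter> ?V) ?e"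
    using r s min by (rule convex_sum_min_imp_normal_to_lifted_graph)
  ultimately obtain n m where n: "n \<in> normal_cone ?E ?e" and m: "m \<in> normal_cone ?V ?e"
    and sum_eq: "((0, -1), (0, -1), - c) = n + m"
    by (rule normal_cone_sum_ruleE)
  from m obtain x v d where m_eq: "m = ((x, 0), (v, 0), d)"
    and orth: "inner x (L w') + inner v (M w') + inner d w' = 0" for w'
    unfolding normal_cone_lifted_graph[OF L M IntD2[OF e]] by auto
  have "n = ((0, -1), (0, -1), - c) - m" using sum_eq by (simp add: algebra_simps)
  then have "n = ((- x, -1), (- v, -1), - c - d)" by (simp add: m_eq)
  then have normals: "(- x, -1) \<in> normal_cone (epi F) (L w, r)"
    "(- v, -1) \<in> normal_cone (epi G) (M w, s)"
    "- c - d \<in> normal_cone U w"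
    using n e by (auto simp: normal_cone_Times)
  show ?thesis
  proof
    show "- x \<in> subdiff F (L w)" "- v \<in> subdiff G (M w)"
      using normals by (simp_all add: subdiff_iff_normal_cone_epi r s)
    show "inner (- x) (L w') + inner (- v) (M w') + inner c w' = 0" if "w' \<in> U" for w'
    proof -
      have "inner (- c - d) w' = 0"
        using normals(3) that w(1) by (simp add: normal_cone_subspace[OF U])
      then show ?thesis using orth[of w'] by (simp add: inner_diff_left)
    qed
  qed
qed

section \<open>Limiting subgradients and local minimizers\<close>

lemma frechet_subdiff_iff_eventually:
  "v \<in> frechet_subdiff h x \<longleftrightarrow> \<bar>h x\<bar> \<noteq> \<infinity> \<and> (\<forall>e>0. \<forall>\<^sub>F y in nhds x.
     ereal (real_of_ereal (h x) + inner v (y - x) - e * norm (y - x)) \<le> h y)"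
  by (simp add: frechet_subdiff_def eventually_nhds_metric dist_norm)

lemma eventually_nhds_snd:
  assumes "\<forall>\<^sub>F z in nhds (snd w). P z"
  shows "\<forall>\<^sub>F w' in nhds w. P (snd w')"
  using assms tendsto_snd[OF filterlim_ident] by (rule eventually_compose_filterlim)

lemma local_minimizer_iff_eventually: "local_minimizer h x \<longleftrightarrow> (\<forall>\<^sub>F y in nhds x. h x \<le> h y)"
  by (auto simp: local_minimizer_def eventually_nhds_metric dist_commute)

lemma tendsto_along_ray: "((\<lambda>t. x + t *\<^sub>R d) \<longlongrightarrow> x) (at_right (0::real))"
  for x d :: "'a::real_normed_vector"
proof -
  have "((\<lambda>t. x + t *\<^sub>R d) \<longlongrightarrow> x + 0 *\<^sub>R d) (at_right (0::real))" by (intro tendsto_intros)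
  then show ?thesis by simp
qed

lemma frechet_subdiff_le_slope:
  assumes v: "v \<in> frechet_subdiff h x"
    and slope: "\<forall>\<^sub>F t in at_right 0. h (x + t *\<^sub>R d) \<le> h x + ereal (t * c)"
  shows "inner v d \<le> c"
proof -
  obtain r where r: "h x = ereal r" using v by (auto simp: frechet_subdiff_def)
  have relaxed: "inner v d \<le> c + e * norm d" if "0 < e" for e
  proof -
    have "\<forall>\<^sub>F y in nhds x. ereal (r + inner v (y - x) - e * norm (y - x)) \<le> h y"
      using v that by (simp add: frechet_subdiff_iff_eventually r)
    then have "\<forall>\<^sub>F t in at_right 0.
        ereal (r + inner v (t *\<^sub>R d) - e * norm (t *\<^sub>R d)) \<le> h (x + t *\<^sub>R d)"
      using eventually_compose_filterlim[OF _ tendsto_along_ray[of x d]] by fastforce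
    with slope eventually_at_right_less[of 0]
    have "\<forall>\<^sub>F t :: real in at_right 0. inner v d \<le> c + e * norm d"
    proof eventually_elim
      case (elim t)
      have "ereal (r + inner v (t *\<^sub>R d) - e * norm (t *\<^sub>R d)) \<le> ereal (r + t * c)"
        using order_trans[OF elim(3,1)] by (simp add: r)
      then have "t * inner v d \<le> t * (c + e * norm d)" using elim(2) by (simp add: algebra_simps)
      then show ?case using elim(2) by simp
    qed
    then show ?thesis by simp
  qed
  have "((\<lambda>e. c + e * norm d) \<longlongrightarrow> c + 0 * norm d) (at_right 0)" by (intro tendsto_intros)
  then show ?thesis
    using relaxed by (intro tendsto_lowerbound[of _ c "at_right 0"])
      (auto intro: eventually_mono[OF eventually_at_right_less])
qed

lemma frechet_subdiff_subset_subdiff: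
  assumes h: "convex_fun h"
  shows "frechet_subdiff h x \<subseteq> subdiff h x"
proof
  fix v assume v: "v \<in> frechet_subdiff h x"
  then obtain r where r: "h x = ereal r" by (auto simp: frechet_subdiff_def)
  have "ereal (r + inner v (y - x)) \<le> ereal s" if s: "h y \<le> ereal s" for y s
  proof -
    have "\<forall>\<^sub>F t :: real in at_right 0. t \<in> {0<..<1}"
      by (rule eventually_at_right_real) simp
    then have "\<forall>\<^sub>F t in at_right 0. h (x + t *\<^sub>R (y - x)) \<le> h x + ereal (t * (s - r))"
    proof eventually_elim
      case (elim t)
      then have "h ((1 - t) *\<^sub>R x + t *\<^sub>R y) \<le> ereal ((1 - t) * r + t * s)"
        by (intro convex_fun_combination_le[OF h]) (auto simp: r s)
      then show ?case by (simp add: r algebra_simps)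
    qed
    then have "inner v (y - x) \<le> s - r" by (rule frechet_subdiff_le_slope[OF v])
    then show ?thesis by simp
  qed
  then show "v \<in> subdiff h x" by (auto simp: subdiff_def r intro: ereal_le_real)
qed

lemma limiting_subdiffI_eventually:
  assumes "\<bar>h x\<bar> \<noteq> \<infinity>" "\<forall>\<^sub>F y in nhds x. h x + ereal (inner v (y - x)) \<le> h y"
  shows "v \<in> limiting_subdiff h x"
proof -
  obtain r where r: "h x = ereal r" using assms(1) by auto
  have "\<forall>\<^sub>F y in nhds x. ereal (r + inner v (y - x) - e * norm (y - x)) \<le> h y" if "0 < e" for e
    using assms(2)
  proof eventually_elim
    case (elim y)
    have "ereal (r + inner v (y - x) - e * norm (y - x)) \<le> h x + ereal (inner v (y - x))"
      using that by (simp add: r)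
    also note elim
    finally show ?case .
  qed
  then have "v \<in> frechet_subdiff h x" by (simp add: frechet_subdiff_iff_eventually r)
  then show ?thesis
    unfolding limiting_subdiff_def by (intro CollectI exI[of _ "\<lambda>_. x"] exI[of _ "\<lambda>_. v"]) auto
qed

lemma limiting_subdiff_convex:
  assumes h: "convex_fun h"
  shows "limiting_subdiff h x = subdiff h x"
proof (intro equalityI subsetI)
  fix v assume "v \<in> limiting_subdiff h x"
  then obtain xs vs where xs: "xs \<longlonglongrightarrow> x" "(\<lambda>k. h (xs k)) \<longlonglongrightarrow> h x" "vs \<longlonglongrightarrow> v"
    and vs: "\<And>k. vs k \<in> subdiff h (xs k)"
    using frechet_subdiff_subset_subdiff[OF h] unfolding limiting_subdiff_def by blast
  have subgradient: "h x + ereal (inner v (y - x)) \<le> h y" for y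
  proof (rule LIMSEQ_le_const2)
    show "(\<lambda>k. h (xs k) + ereal (inner (vs k) (y - xs k))) \<longlonglongrightarrow> h x + ereal (inner v (y - x))"
      using xs by (intro tendsto_add_ereal_general1) (auto intro!: tendsto_intros)
    show "\<exists>N. \<forall>k\<ge>N. h (xs k) + ereal (inner (vs k) (y - xs k)) \<le> h y"
      using vs by (auto simp: subdiff_def)
  qed
  obtain r where "h (xs 0) = ereal r" using vs[of 0] by (auto simp: subdiff_def)
  then have "\<bar>h x\<bar> \<noteq> \<infinity>"
    using subgradient[of "xs 0"] vs[of 0]
    by (cases "h x") (auto simp: subdiff_def dest: spec[of _ x])
  with subgradient show "v \<in> subdiff h x" by (simp add: subdiff_def)
next
  fix v assume "v \<in> subdiff h x"
  then show "v \<in> limiting_subdiff h x"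
    by (intro limiting_subdiffI_eventually) (auto simp: subdiff_def)
qed

lemma convex_fun_local_min_on_imp_min_on:
  fixes h :: "'a::real_normed_vector \<Rightarrow> ereal"
  assumes h: "convex_fun h" and U: "convex U" and x: "x \<in> U" "\<bar>h x\<bar> \<noteq> \<infinity>"
    and local_min: "\<forall>\<^sub>F y in nhds x. y \<in> U \<longrightarrow> h x \<le> h y" and y: "y \<in> U"
  shows "h x \<le> h y"
proof -
  obtain r where r: "h x = ereal r" using x(2) by auto
  have "ereal r \<le> ereal s" if s: "h y \<le> ereal s" for s
  proof -
    have "\<forall>\<^sub>F t in at_right 0. x + t *\<^sub>R (y - x) \<in> U \<longrightarrow> h x \<le> h (x + t *\<^sub>R (y - x))"
      using local_min by (rule eventually_compose_filterlim) (rule tendsto_along_ray)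
    moreover have "\<forall>\<^sub>F t :: real in at_right 0. t \<in> {0<..<1}"
      by (rule eventually_at_right_real) simp
    ultimately have "\<forall>\<^sub>F t :: real in at_right 0. r \<le> s"
    proof eventually_elim
      case (elim t)
      have segment: "x + t *\<^sub>R (y - x) = (1 - t) *\<^sub>R x + t *\<^sub>R y" by (simp add: algebra_simps)
      have "x + t *\<^sub>R (y - x) \<in> U"
        unfolding segment using elim by (intro convexD[OF U x(1) y]) auto
      then have "ereal r \<le> h (x + t *\<^sub>R (y - x))" using elim by (simp add: r)
      also have "\<dots> \<le> ereal ((1 - t) * r + t * s)"
        unfolding segment using elim by (intro convex_fun_combination_le[OF h]) (auto simp: r s)
      finally have "t * r \<le> t * s" by (simp add: algebra_simps)
      then show ?case using elim by simp
    qed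
    then show ?thesis by simp
  qed
  then show ?thesis unfolding r by (rule ereal_le_real)
qed

section \<open>The penalty\<close>

definition support_space :: "real^'r \<Rightarrow> (real^'r) set" where
  "support_space z = {d. \<forall>i. z $ i = 0 \<longrightarrow> d $ i = 0}"

lemma subspace_support_space: "subspace (support_space z)"
  by (auto simp: subspace_def support_space_def)

lemma axis_in_support_space: "z $ i \<noteq> 0 \<Longrightarrow> axis i c \<in> support_space z"
  by (auto simp: support_space_def axis_def)

lemma Psi_plus_finite_iff: "\<bar>Psi_plus \<mu> z\<bar> \<noteq> \<infinity> \<longleftrightarrow> (\<forall>i. 0 \<le> z $ i)"
  by (simp add: Psi_plus_def)

lemma tendsto_vec_nth_nhds: "((\<lambda>x. x $ i) \<longlongrightarrow> z $ i) (nhds z)"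
  by (rule tendsto_vec_nth[OF filterlim_ident])

lemma Psi_plus_locally_constant_on_support_space:
  assumes z: "\<forall>i. 0 \<le> z $ i"
  shows "\<forall>\<^sub>F y in nhds z. y \<in> support_space z \<longrightarrow> Psi_plus \<mu> y = Psi_plus \<mu> z"
proof -
  have "\<forall>\<^sub>F y in nhds z. z $ i \<noteq> 0 \<longrightarrow> 0 < y $ i" for i
  proof (cases "z $ i = 0")
    case False
    then have "0 < z $ i" using z by (simp add: less_le)
    then show ?thesis
      using order_tendstoD(1)[OF tendsto_vec_nth_nhds] by (auto elim: eventually_mono)
  qed simp
  then have "\<forall>\<^sub>F y in nhds z. \<forall>i. z $ i \<noteq> 0 \<longrightarrow> 0 < y $ i" by (rule eventually_all_finite)
  then show ?thesis
  proof eventually_elim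
    case (elim y)
    show ?case
    proof
      assume "y \<in> support_space z"
      then have "y $ i = 0 \<longleftrightarrow> z $ i = 0" "0 \<le> y $ i" for i
        using elim[rule_format, of i] by (cases "z $ i = 0"; auto simp: support_space_def)+
      then show "Psi_plus \<mu> y = Psi_plus \<mu> z" using z by (simp add: Psi_plus_def)
    qed
  qed
qed

lemma frechet_subdiff_Psi_plus_orthogonal_support_space:
  assumes v: "v \<in> frechet_subdiff (Psi_plus \<mu>) z" and d: "d \<in> support_space z"
  shows "inner v d = 0"
proof -
  have z: "\<forall>i. 0 \<le> z $ i"
    using v Psi_plus_finite_iff[of \<mu> z] by (simp add: frechet_subdiff_def)
  have "inner v d \<le> 0" if "d \<in> support_space z" for d
  proof (rule frechet_subdiff_le_slope[OF v])
    have "\<forall>\<^sub>F t in at_right 0. z + t *\<^sub>R d \<in> support_space z \<longrightarrow>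
        Psi_plus \<mu> (z + t *\<^sub>R d) = Psi_plus \<mu> z"
      using Psi_plus_locally_constant_on_support_space[OF z]
      by (rule eventually_compose_filterlim) (rule tendsto_along_ray)
    then show "\<forall>\<^sub>F t in at_right 0. Psi_plus \<mu> (z + t *\<^sub>R d) \<le> Psi_plus \<mu> z + ereal (t * 0)"
      by eventually_elim (use that in \<open>simp add: support_space_def\<close>)
  qed
  from this[of d] this[of "- d"] d show ?thesis
    by (simp add: subspace_neg[OF subspace_support_space])
qed

lemma Psi_plus_growth:
  assumes \<mu>: "\<forall>i. 0 < \<mu> $ i" and z: "\<forall>i. 0 \<le> z $ i" and u: "\<forall>i. z $ i \<noteq> 0 \<longrightarrow> u $ i = 0"
  shows "\<forall>\<^sub>F y in nhds z. Psi_plus \<mu> z + ereal (inner u (y - z)) \<le> Psi_plus \<mu> y"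
proof -
  let ?\<pi> = "\<lambda>i c. if c \<noteq> 0 then \<mu> $ i else (0::real)"
  have "\<forall>\<^sub>F y in nhds z. ?\<pi> i (z $ i) + u $ i * (y $ i - z $ i) \<le> ?\<pi> i (y $ i)" for i
  proof (cases "z $ i = 0")
    case True
    have "((\<lambda>y. u $ i * y $ i) \<longlongrightarrow> u $ i * z $ i) (nhds z)"
      by (intro tendsto_intros tendsto_vec_nth_nhds)
    then have "\<forall>\<^sub>F y in nhds z. u $ i * y $ i < \<mu> $ i"
      by (rule order_tendstoD) (simp add: True \<mu>)
    then show ?thesis by eventually_elim (simp add: True)
  next
    case False
    have "\<forall>\<^sub>F y in nhds z. y $ i \<noteq> 0"
      by (rule tendsto_imp_eventually_ne[OF tendsto_vec_nth_nhds False])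
    then show ?thesis by eventually_elim (use u False in simp)
  qed
  then have "\<forall>\<^sub>F y in nhds z. \<forall>i. ?\<pi> i (z $ i) + u $ i * (y $ i - z $ i) \<le> ?\<pi> i (y $ i)"
    by (rule eventually_all_finite)
  then show ?thesis
  proof eventually_elim
    case (elim y)
    have "(\<Sum>i\<in>UNIV. ?\<pi> i (z $ i) + u $ i * (y $ i - z $ i)) \<le> (\<Sum>i\<in>UNIV. ?\<pi> i (y $ i))"
      using elim by (intro sum_mono) simp
    then show ?case
      using z by (simp add: Psi_plus_def inner_vec_def sum.distrib)
  qed
qed

theorem limiting_subdiff_Psi_plus:
  fixes \<mu> z :: "real^'r"
  assumes \<mu>: "\<forall>i. 0 < \<mu> $ i"
  shows "limiting_subdiff (Psi_plus \<mu>) z = {u. (\<forall>i. 0 \<le> z $ i) \<and> (\<forall>i. z $ i \<noteq> 0 \<longrightarrow> u $ i = 0)}"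
proof (intro equalityI subsetI)
  fix u :: "real^'r" assume "u \<in> limiting_subdiff (Psi_plus \<mu>) z"
  then obtain zs us where zs: "zs \<longlonglongrightarrow> z" and us: "us \<longlonglongrightarrow> u"
    and frechet: "\<And>k. us k \<in> frechet_subdiff (Psi_plus \<mu>) (zs k)"
    unfolding limiting_subdiff_def by blast
  have "0 \<le> z $ i" for i
  proof (rule LIMSEQ_le_const[OF tendsto_vec_nth[OF zs]])
    show "\<exists>N. \<forall>k\<ge>N. 0 \<le> zs k $ i"
      using frechet Psi_plus_finite_iff[of \<mu>] by (auto simp: frechet_subdiff_def)
  qed
  moreover have "u $ i = 0" if "z $ i \<noteq> 0" for i
  proof -
    have "\<forall>\<^sub>F k in sequentially. zs k $ i \<noteq> 0"
      using that by (rule tendsto_imp_eventually_ne[OF tendsto_vec_nth[OF zs]])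
    then have "\<forall>\<^sub>F k in sequentially. us k $ i = 0"
    proof eventually_elim
      case (elim k)
      show ?case
        using frechet_subdiff_Psi_plus_orthogonal_support_space[OF frechet
            axis_in_support_space[OF elim, of 1]]
        by (simp add: inner_axis)
    qed
    then show ?thesis
      using LIMSEQ_unique[OF tendsto_vec_nth[OF us] tendsto_eventually] by blast
  qed
  ultimately show "u \<in> {u. (\<forall>i. 0 \<le> z $ i) \<and> (\<forall>i. z $ i \<noteq> 0 \<longrightarrow> u $ i = 0)}" by blast
next
  fix u :: "real^'r" assume "u \<in> {u. (\<forall>i. 0 \<le> z $ i) \<and> (\<forall>i. z $ i \<noteq> 0 \<longrightarrow> u $ i = 0)}"
  then show "u \<in> limiting_subdiff (Psi_plus \<mu>) z"
    using Psi_plus_finite_iff[of \<mu> z]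
    by (intro limiting_subdiffI_eventually Psi_plus_growth[OF \<mu>]) auto
qed

section \<open>Stationarity and local minimality\<close>

definition dual_map :: "real^'n^'m \<Rightarrow> real^'n^'r \<Rightarrow> (real^'m) \<times> (real^'r) \<Rightarrow> real^'n" where
  "dual_map A B w = - (transpose A *v fst w) - (transpose B *v snd w)"

lemma inner_transpose_mult: "inner x (transpose M *v y) = inner (M *v x) y"
  for M :: "real^'n^'m"
  by (metis dot_lmul_matrix inner_commute transpose_matrix_vector)

lemma linear_dual_map: "linear (dual_map A B)"
  by (rule linearI)
    (simp_all add: dual_map_def matrix_vector_right_distrib matrix_vector_mult_scaleR algebra_simps
      del: transpose_matrix_vector)

lemma inner_dual_map: "inner x (dual_map A B w) = - inner (A *v x) (fst w) - inner (B *v x) (snd w)"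
  by (simp add: dual_map_def inner_diff_right inner_transpose_mult del: transpose_matrix_vector)

lemma Xi_fun_eq:
  "Xi_fun f g A B b w = conj_fun f (dual_map A B w) + conj_fun g (fst w) + ereal (inner (0, b) w)"
  by (simp add: Xi_fun_def dual_map_def split_beta inner_prod_def)

lemma convex_fun_Xi_fun: "convex_fun (Xi_fun f g A B b)"
  unfolding Xi_fun_eq[abs_def]
  by (intro convex_fun_add convex_fun_inner convex_fun_conj_fun
      convex_fun_linear_compose[OF linear_dual_map] convex_fun_linear_compose[OF linear_fst])

lemma stationary_D_iff:
  assumes "\<forall>i. 0 < \<mu> $ i"
  shows "stationary_D f g A B b \<mu> (y, z) \<longleftrightarrow> (\<forall>i. 0 \<le> z $ i) \<and>
    (\<exists>x \<in> subdiff (conj_fun f) (dual_map A B (y, z)).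
      A *v x \<in> subdiff (conj_fun g) y \<and> (\<forall>i. z $ i \<noteq> 0 \<longrightarrow> (B *v x) $ i = b $ i))"
proof -
  have "B *v x = b + u \<longleftrightarrow> u = B *v x - b" for x u by (auto simp: algebra_simps)
  then show ?thesis
    by (auto simp: stationary_D_def dual_map_def limiting_subdiff_convex[OF convex_fun_conj_fun]
        limiting_subdiff_Psi_plus[OF assms] simp del: transpose_matrix_vector)
qed

lemma subgradients_imp_Xi_fun_minorant:
  assumes x: "x \<in> subdiff (conj_fun f) (dual_map A B w)"
    and Ax: "A *v x \<in> subdiff (conj_fun g) (fst w)"
  shows "\<bar>Xi_fun f g A B b w\<bar> \<noteq> \<infinity>"
    and "Xi_fun f g A B b w + ereal (inner (b - B *v x) (snd w' - snd w)) \<le> Xi_fun f g A B b w'"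
proof -
  obtain r s where r: "conj_fun f (dual_map A B w) = ereal r" and s: "conj_fun g (fst w) = ereal s"
    using x Ax by (auto simp: subdiff_def)
  then show "\<bar>Xi_fun f g A B b w\<bar> \<noteq> \<infinity>" by (simp add: Xi_fun_eq)
  have "inner x (dual_map A B w' - dual_map A B w) + inner (A *v x) (fst w' - fst w)
      + inner b (snd w')
      = inner b (snd w) + inner (b - B *v x) (snd w' - snd w)"
    by (simp add: inner_diff_right inner_diff_left inner_dual_map)
  then have "Xi_fun f g A B b w + ereal (inner (b - B *v x) (snd w' - snd w)) =
      (ereal r + ereal (inner x (dual_map A B w' - dual_map A B w)))
      + (ereal s + ereal (inner (A *v x) (fst w' - fst w))) + ereal (inner (0, b) w')"
    by (simp add: Xi_fun_eq r s inner_prod_def)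
  also have "\<dots> \<le> Xi_fun f g A B b w'"
    unfolding Xi_fun_eq using x Ax by (intro add_mono order_refl) (auto simp: subdiff_def r s)
  finally show "Xi_fun f g A B b w + ereal (inner (b - B *v x) (snd w' - snd w))
      \<le> Xi_fun f g A B b w'" .
qed

theorem stationary_imp_local_minimizer:
  assumes \<mu>: "\<forall>i. 0 < \<mu> $ i"
    and stationary: "stationary_D f g A B b \<mu> (y, z)"
  shows "local_minimizer (G_fun f g A B b \<mu>) (y, z)"
proof -
  obtain x where z: "\<forall>i. 0 \<le> z $ i"
    and x: "x \<in> subdiff (conj_fun f) (dual_map A B (y, z))"
      "A *v x \<in> subdiff (conj_fun g) (fst (y, z))"
    and u: "\<forall>i. z $ i \<noteq> 0 \<longrightarrow> (B *v x - b) $ i = 0"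
    using stationary by (auto simp: stationary_D_iff[OF \<mu>])
  note Xi_minorant = subgradients_imp_Xi_fun_minorant[OF x, of b]
  have "\<forall>\<^sub>F w in nhds (y, z).
      Psi_plus \<mu> z + ereal (inner (B *v x - b) (snd w - z)) \<le> Psi_plus \<mu> (snd w)"
    using Psi_plus_growth[OF \<mu> z u] by (intro eventually_nhds_snd) simp
  then show ?thesis
    unfolding local_minimizer_iff_eventually
  proof eventually_elim
    case (elim w)
    obtain r p where "Xi_fun f g A B b (y, z) = ereal r" "Psi_plus \<mu> z = ereal p"
      using Xi_minorant(1) z Psi_plus_finite_iff[of \<mu> z] by auto
    then have "G_fun f g A B b \<mu> (y, z) =
        (Xi_fun f g A B b (y, z) + ereal (inner (b - B *v x) (snd w - z)))
        + (Psi_plus \<mu> z + ereal (inner (B *v x - b) (snd w - z)))"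
      by (simp add: G_fun_def inner_diff_left)
    also have "\<dots> \<le> G_fun f g A B b \<mu> w"
      unfolding G_fun_def using Xi_minorant(2)[of w] elim by (intro add_mono) simp_all
    finally show ?case .
  qed
qed

lemma local_minimizer_imp_Xi_fun_min:
  assumes min: "local_minimizer (G_fun f g A B b \<mu>) (y, z)"
    and fin: "\<bar>Xi_fun f g A B b (y, z)\<bar> \<noteq> \<infinity>" and z: "\<forall>i. 0 \<le> z $ i"
    and w: "w \<in> UNIV \<times> support_space z"
  shows "Xi_fun f g A B b (y, z) \<le> Xi_fun f g A B b w"
proof (rule convex_fun_local_min_on_imp_min_on[OF convex_fun_Xi_fun _ _ fin _ w])
  show "convex (UNIV \<times> support_space z)"
    by (intro convex_Times convex_UNIV subspace_imp_convex subspace_support_space)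
  show "(y, z) \<in> UNIV \<times> support_space z" by (simp add: support_space_def)
  have "\<forall>\<^sub>F w in nhds (y, z). snd w \<in> support_space z \<longrightarrow> Psi_plus \<mu> (snd w) = Psi_plus \<mu> z"
    using Psi_plus_locally_constant_on_support_space[OF z] by (intro eventually_nhds_snd) simp
  then show "\<forall>\<^sub>F w in nhds (y, z). w \<in> UNIV \<times> support_space z \<longrightarrow>
      Xi_fun f g A B b (y, z) \<le> Xi_fun f g A B b w"
    using min[unfolded local_minimizer_iff_eventually]
  proof eventually_elim
    case (elim w)
    show ?case
    proof
      assume "w \<in> UNIV \<times> support_space z"
      then have "Xi_fun f g A B b (y, z) + Psi_plus \<mu> z \<le> Xi_fun f g A B b w + Psi_plus \<mu> z"
        using elim by (auto simp: G_fun_def)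
      then show "Xi_fun f g A B b (y, z) \<le> Xi_fun f g A B b w"
        using z Psi_plus_finite_iff[of \<mu> z] by (auto simp: ereal_add_le_add_iff2)
    qed
  qed
qed

lemma G_fun_less_PInfty_iff:
  assumes "proper_fun f" "proper_fun g"
  shows "G_fun f g A B b \<mu> (y, z) < \<infinity> \<longleftrightarrow>
    \<bar>conj_fun f (dual_map A B (y, z))\<bar> \<noteq> \<infinity> \<and> \<bar>conj_fun g y\<bar> \<noteq> \<infinity> \<and> (\<forall>i. 0 \<le> z $ i)"
  unfolding G_fun_def Xi_fun_eq
  using conj_fun_not_MInfty[OF assms(1), of "dual_map A B (y, z)"]
    conj_fun_not_MInfty[OF assms(2), of y]
  by (cases "conj_fun f (dual_map A B (y, z))"; cases "conj_fun g y") (simp_all add: Psi_plus_def)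

theorem local_minimizer_imp_stationary:
  assumes f: "proper_fun f" and g: "proper_fun g" and \<mu>: "\<forall>i. 0 < \<mu> $ i"
    and min: "local_minimizer (G_fun f g A B b \<mu>) (y, z)"
    and fin: "G_fun f g A B b \<mu> (y, z) < \<infinity>" and slater: "slater_D f g A B z"
  shows "stationary_D f g A B b \<mu> (y, z)"
proof -
  have conj_finite: "\<bar>conj_fun f (dual_map A B (y, z))\<bar> \<noteq> \<infinity>" "\<bar>conj_fun g (fst (y, z))\<bar> \<noteq> \<infinity>"
    and z: "\<forall>i. 0 \<le> z $ i"
    using fin unfolding G_fun_less_PInfty_iff[OF f g] by simp_all
  let ?U = "UNIV \<times> support_space z"
  have U: "subspace ?U" by (intro subspace_Times subspace_UNIV subspace_support_space)
  obtain w0 where w0: "w0 \<in> ?U" "dual_map A B w0 \<in> qualified_domain (conj_fun f)"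
    "fst w0 \<in> qualified_domain (conj_fun g)"
    using slater unfolding slater_D_def dual_map_def qualified_domain_def support_space_def by force
  have yz: "(y, z) \<in> ?U" by (simp add: support_space_def)
  have "\<bar>Xi_fun f g A B b (y, z)\<bar> \<noteq> \<infinity>" using conj_finite by (auto simp: Xi_fun_eq)
  note Xi_min = local_minimizer_imp_Xi_fun_min[OF min this z, unfolded Xi_fun_eq]
  from convex_sum_min_on_subspace_imp_subgradients[OF convex_fun_conj_fun convex_fun_conj_fun
      linear_dual_map linear_fst U w0 yz conj_finite Xi_min]
  obtain x v where x: "x \<in> subdiff (conj_fun f) (dual_map A B (y, z))"
    and v: "v \<in> subdiff (conj_fun g) (fst (y, z))"
    and orth: "\<And>w. w \<in> ?U \<Longrightarrow> inner x (dual_map A B w) + inner v (fst w) + inner (0, b) w = 0"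
    by metis
  have "inner (v - A *v x) (v - A *v x) = 0"
    using orth[of "(v - A *v x, 0)"] by (simp add: inner_dual_map inner_diff_left support_space_def)
  then have "A *v x = v" by simp
  moreover have "(B *v x) $ i = b $ i" if "z $ i \<noteq> 0" for i
    using orth[of "(0, axis i 1)"] axis_in_support_space[OF that]
    by (simp add: inner_dual_map inner_axis)
  ultimately show ?thesis
    using x v z by (auto simp: stationary_D_iff[OF \<mu>])
qed

theorem mainTheorem14:
  fixes f :: "real^'n \<Rightarrow> ereal" and g :: "real^'m \<Rightarrow> ereal"
    and A :: "real^'n^'m" and B :: "real^'n^'r" and b :: "real^'r" and \<mu> :: "real^'r"
  assumes "proper_fun f" "lsc_fun f" "convex_fun f"
    and "proper_fun g" "lsc_fun g" "convex_fun g"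
    and "\<forall>i. 0 < \<mu> $ i"
  shows "(\<forall>w. stationary_D f g A B b \<mu> w \<longrightarrow> local_minimizer (G_fun f g A B b \<mu>) w)
    \<and> (\<forall>ys zs. local_minimizer (G_fun f g A B b \<mu>) (ys, zs)
          \<and> G_fun f g A B b \<mu> (ys, zs) < \<infinity>
          \<and> slater_D f g A B zs
          \<longrightarrow> stationary_D f g A B b \<mu> (ys, zs))"
  using stationary_imp_local_minimizer[OF assms(7)]
    local_minimizer_imp_stationary[OF assms(1,4,7)]
  by (metis surj_pair)

end
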